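(* Let $\mathbf W=(G,m)$ be a finite weighted graph and $E_0\subset E(G)$. Let $V_0\subset V(G)$ be any vertex set in the neighbourhood of $E_0$, let $\mathbf W^-=(G-E_0,m^-)$ be obtained by virtualising the edges $E_0$ and $\mathbf W^+=(G-V_0,m^+)$ by virtualising the vertices $V_0$, and let $\Delta^{\mathbf W^\pm}$ be the corresponding Laplacians with zero vector potential. Then for every vector potential $\alpha$ supported in $E_0$, \[ \Delta^{\mathbf W^-}\preccurlyeq\Delta^{\mathbf W}_\alpha\preccurlyeq\Delta^{\mathbf W^+}. \] In particular \[ \sigma(\Delta^{\mathbf W}_\alpha)\subset J:=\bigcup_{k=1}^{|V(G)|}\bigl[\lambda_k(\Delta^{\mathbf W^-}),\lambda_k(\Delta^{\mathbf W^+})\bigr], \] where $J$ does not depend on the vector potential $\alpha$ (and $\lambda_k(\Delta^{\mathbf W^+}):=2\rho_\infty$ for $k>|V(G)|-|V_0|$).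
   Context: A graph $G=(V,E,\partial)$ has orientation $\partial e=(\partial_-e,\partial_+e)$; loops and multiple edges allowed. $E_v$ is the disjoint union of $\{e:\partial_+e=v\}$ and $\{e:\partial_-e=v\}$ (a loop counts twice). A weight $m$: $m:V\to(0,\infty)$, $m:E\to(0,\infty)$; relative weight $\rho(v)=\sum_{e\in E_v}m_e/m(v)$, $\rho_\infty=\max_v\rho(v)$. $\ell_2(V,m)$, $\ell_2(E,m)$ carry inner products $\sum_v f(v)\overline{g(v)}m(v)$, $\sum_e\eta_e\overline{\zeta_e}m_e$. A vector potential is $\alpha:E\to\mathbb R/2\pi\mathbb Z$; it is supported in $E_0$ if $\alpha_e=0$ for $e\notin E_0$. $(d_\alpha f)_e=e^{i\alpha_e/2}f(\partial_+e)-e^{-i\alpha_e/2}f(\partial_-e)$, $\Delta^{\mathbf W}_\alpha=d_\alpha^*d_\alpha$, $\Delta=\Delta_0$. Edge virtualisation: $\mathbf W^-$ has vertex set $V$ with the same vertex weights, edge set $E\setminus E_0$ with same weights and orientations; its Laplacian is $d^*d$ on $\ell_2(V,m)$ with $d$ the derivative of $G-E_0$. Vertex virtualisation: $\mathbf W^+$ has vertex set $V\setminus V_0$ with weights $m(v)$, edge set $E\setminus E(V_0)$ ($E(V_0)$ = edges with both endpoints in $V_0$) with weights $m_e$; its Laplacian with potential $\beta$ is $d_{\beta}^+{}^*d^+_\beta$ on $\ell_2(V\setminus V_0,m)$, where $d^+_\beta f=(d_\beta\iota f)|_{E\setminus E(V_0)}$ and $\iota$ extends by zero on $V_0$. $V_0$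 is in the neighbourhood of $E_0$ if every $e\in E_0$ has $\partial_+e\in V_0$ or $\partial_-e\in V_0$. Eigenvalues $\lambda_k$ are in ascending order with multiplicity; $S^-\preccurlyeq S^+$ (dimensions $n^-,n^+$) means $n^-\ge n^+$ and $\lambda_k(S^-)\le\lambda_k(S^+)$ for $1\le k\le n^+$. *)

theory Defs
  imports
    "HOL-Analysis.Analysis"
    "HOL-Library.Function_Algebras"
    "HOL-Library.Real_Mod"
    "Graph_Theory.Digraph"
begin

section \<open>Spectra of operators on spaces of complex functions\<close>

definition cscale :: "complex \<Rightarrow> ('a \<Rightarrow> complex) \<Rightarrow> ('a \<Rightarrow> complex)" where
  "cscale c f = (\<lambda>x. c * f x)"

global_interpretation cfun: vector_space "cscale :: complex \<Rightarrow> ('a \<Rightarrow> complex) \<Rightarrow> ('a \<Rightarrow> complex)"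
  by unfold_locales (auto simp: cscale_def fun_eq_iff algebra_simps)

text \<open>A function on a set \<open>A\<close> is represented by its extension by zero outside \<open>A\<close>.
  For finite \<open>A\<close> all functions are square summable; the weight enters only through the
  inner product.\<close>

definition ell2 :: "'a set \<Rightarrow> ('a \<Rightarrow> complex) set" where
  "ell2 A = {f. \<forall>x. x \<notin> A \<longrightarrow> f x = 0}"

definition restr :: "'a set \<Rightarrow> ('a \<Rightarrow> complex) \<Rightarrow> ('a \<Rightarrow> complex)" where
  "restr A f = (\<lambda>x. if x \<in> A then f x else 0)"

definition winner :: "'a set \<Rightarrow> ('a \<Rightarrow> real) \<Rightarrow> ('a \<Rightarrow> complex) \<Rightarrow> ('a \<Rightarrow> complex) \<Rightarrow> complex" where
  "winner A m f g = (\<Sum>x\<in>A. f x * cnj (g x) * of_real (m x))"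

definition wadjoint ::
  "'a set \<Rightarrow> ('a \<Rightarrow> real) \<Rightarrow> 'b set \<Rightarrow> ('b \<Rightarrow> real) \<Rightarrow>
   (('a \<Rightarrow> complex) \<Rightarrow> ('b \<Rightarrow> complex)) \<Rightarrow> (('b \<Rightarrow> complex) \<Rightarrow> ('a \<Rightarrow> complex))" where
  "wadjoint A m B m' T \<eta> =
     (THE g. g \<in> ell2 A \<and> (\<forall>f\<in>ell2 A. winner B m' (T f) \<eta> = winner A m f g))"

text \<open>An operator is a pair of the space it acts on and the map itself.\<close>

type_synonym 'a cop = "('a \<Rightarrow> complex) set \<times> (('a \<Rightarrow> complex) \<Rightarrow> ('a \<Rightarrow> complex))"

definition op_dim :: "'a cop \<Rightarrow> nat" where
  "op_dim S = cfun.dim (fst S)"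

definition spectrum :: "'a cop \<Rightarrow> complex set" where
  "spectrum S = {z. \<not> bij_betw (\<lambda>f. snd S f - cscale z f) (fst S) (fst S)}"

definition eigenspace :: "'a cop \<Rightarrow> real \<Rightarrow> ('a \<Rightarrow> complex) set" where
  "eigenspace S x = {f \<in> fst S. snd S f = cscale (of_real x) f}"

definition mult_ev :: "'a cop \<Rightarrow> real \<Rightarrow> nat" where
  "mult_ev S x = cfun.dim (eigenspace S x)"

text \<open>Eigenvalues in ascending order, each repeated according to its multiplicity. Only real
  eigenvalues are listed and multiplicities are geometric: this is meant for self-adjoint
  operators on finite-dimensional spaces.\<close>

definition eigenvalue_list :: "'a cop \<Rightarrow> real list" where
  "eigenvalue_list S =
     concat (map (\<lambda>x. replicate (mult_ev S x) x) (sorted_list_of_set {x. mult_ev S x > 0}))"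

text \<open>The index of the eigenvalues starts at \<open>1\<close>.\<close>

definition ev :: "'a cop \<Rightarrow> nat \<Rightarrow> real" where
  "ev S k = eigenvalue_list S ! (k - 1)"

definition spec_le :: "'a cop \<Rightarrow> 'b cop \<Rightarrow> bool"  (infix \<open>\<preceq>\<close> 50) where
  "S \<preceq> T \<longleftrightarrow> op_dim T \<le> op_dim S \<and> (\<forall>k\<in>{1..op_dim T}. ev S k \<le> ev T k)"

section \<open>Weighted graphs and magnetic Laplacians\<close>

text \<open>An arc \<open>e\<close> has \<open>\<partial>\<^sub>+e = head G e\<close> and \<open>\<partial>\<^sub>-e = tail G e\<close>.\<close>

locale weighted_graph = fin_digraph G
  for G :: "('v, 'e) pre_digraph" +
  fixes mV :: "'v \<Rightarrow> real" and mE :: "'e \<Rightarrow> real"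
  assumes vertex_weight_pos: "v \<in> verts G \<Longrightarrow> mV v > 0"
    and edge_weight_pos: "e \<in> arcs G \<Longrightarrow> mE e > 0"

text \<open>Loops occur in both sums.\<close>

definition rel_weight :: "('v, 'e) pre_digraph \<Rightarrow> ('v \<Rightarrow> real) \<Rightarrow> ('e \<Rightarrow> real) \<Rightarrow> 'v \<Rightarrow> real" where
  "rel_weight G mV mE v =
     ((\<Sum>e | e \<in> arcs G \<and> head G e = v. mE e) + (\<Sum>e | e \<in> arcs G \<and> tail G e = v. mE e)) / mV v"

definition max_rel_weight :: "('v, 'e) pre_digraph \<Rightarrow> ('v \<Rightarrow> real) \<Rightarrow> ('e \<Rightarrow> real) \<Rightarrow> real" where
  "max_rel_weight G mV mE = Max (rel_weight G mV mE ` verts G)"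

text \<open>A vector potential with values in \<open>\<real>/2\<pi>\<int>\<close> is represented by an arbitrary real-valued
  lift, so that vanishing means vanishing modulo \<open>2\<pi>\<close>. Another lift changes \<open>(d\<^sub>\<alpha> f) e\<close> by a
  sign depending on \<open>e\<close> only, and leaves the Laplacian unchanged.\<close>

definition supported_in :: "('v, 'e) pre_digraph \<Rightarrow> ('e \<Rightarrow> real) \<Rightarrow> 'e set \<Rightarrow> bool" where
  "supported_in G \<alpha> E0 \<longleftrightarrow> (\<forall>e \<in> arcs G - E0. [\<alpha> e = 0] (rmod (2 * pi)))"

definition deriv_pot ::
  "('v, 'e) pre_digraph \<Rightarrow> ('e \<Rightarrow> real) \<Rightarrow> ('v \<Rightarrow> complex) \<Rightarrow> ('e \<Rightarrow> complex)" where
  "deriv_pot G \<alpha> f = restr (arcs G)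
     (\<lambda>e. exp (\<i> * of_real (\<alpha> e) / 2) * f (head G e) - exp (- \<i> * of_real (\<alpha> e) / 2) * f (tail G e))"

definition laplacian ::
  "('v, 'e) pre_digraph \<Rightarrow> ('v \<Rightarrow> real) \<Rightarrow> ('e \<Rightarrow> real) \<Rightarrow> ('e \<Rightarrow> real) \<Rightarrow> 'v cop" where
  "laplacian G mV mE \<alpha> =
     (ell2 (verts G),
      \<lambda>f. wadjoint (verts G) mV (arcs G) mE (deriv_pot G \<alpha>) (deriv_pot G \<alpha> f))"

definition del_edges :: "('v, 'e) pre_digraph \<Rightarrow> 'e set \<Rightarrow> ('v, 'e) pre_digraph" where
  "del_edges G E0 = G\<lparr>arcs := arcs G - E0\<rparr>"

definition edge_virt_laplacian ::
  "('v, 'e) pre_digraph \<Rightarrow> ('v \<Rightarrow> real) \<Rightarrow> ('e \<Rightarrow> real) \<Rightarrow> 'e set \<Rightarrow> 'v cop" where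
  "edge_virt_laplacian G mV mE E0 = laplacian (del_edges G E0) mV mE (\<lambda>_. 0)"

definition edges_within :: "('v, 'e) pre_digraph \<Rightarrow> 'v set \<Rightarrow> 'e set" where
  "edges_within G V0 = {e \<in> arcs G. head G e \<in> V0 \<and> tail G e \<in> V0}"

text \<open>\<open>G - V0\<close> is only a partial graph: an edge with exactly one endpoint in \<open>V0\<close> is kept.
  The inner \<open>restr\<close> is the extension by zero on \<open>V0\<close>.\<close>

definition vertex_virt_deriv ::
  "('v, 'e) pre_digraph \<Rightarrow> 'v set \<Rightarrow> ('e \<Rightarrow> real) \<Rightarrow> ('v \<Rightarrow> complex) \<Rightarrow> ('e \<Rightarrow> complex)" where
  "vertex_virt_deriv G V0 \<beta> f =
     restr (arcs G - edges_within G V0) (deriv_pot G \<beta> (restr (verts G - V0) f))"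

definition vertex_virt_laplacian ::
  "('v, 'e) pre_digraph \<Rightarrow> ('v \<Rightarrow> real) \<Rightarrow> ('e \<Rightarrow> real) \<Rightarrow> 'v set \<Rightarrow> ('e \<Rightarrow> real) \<Rightarrow> 'v cop" where
  "vertex_virt_laplacian G mV mE V0 \<beta> =
     (ell2 (verts G - V0),
      \<lambda>f. wadjoint (verts G - V0) mV (arcs G - edges_within G V0) mE
            (vertex_virt_deriv G V0 \<beta>) (vertex_virt_deriv G V0 \<beta> f))"

definition in_neighbourhood :: "('v, 'e) pre_digraph \<Rightarrow> 'v set \<Rightarrow> 'e set \<Rightarrow> bool" where
  "in_neighbourhood G V0 E0 \<longleftrightarrow> (\<forall>e\<in>E0. head G e \<in> V0 \<or> tail G e \<in> V0)"

definition upper_ev ::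
  "('v, 'e) pre_digraph \<Rightarrow> ('v \<Rightarrow> real) \<Rightarrow> ('e \<Rightarrow> real) \<Rightarrow> 'v set \<Rightarrow> nat \<Rightarrow> real" where
  "upper_ev G mV mE V0 k =
     (if k \<le> card (verts G) - card V0 then ev (vertex_virt_laplacian G mV mE V0 (\<lambda>_. 0)) k
      else 2 * max_rel_weight G mV mE)"

definition bracketing_set ::
  "('v, 'e) pre_digraph \<Rightarrow> ('v \<Rightarrow> real) \<Rightarrow> ('e \<Rightarrow> real) \<Rightarrow> 'e set \<Rightarrow> 'v set \<Rightarrow> real set" where
  "bracketing_set G mV mE E0 V0 =
     (\<Union>k\<in>{1..card (verts G)}. {ev (edge_virt_laplacian G mV mE E0) k .. upper_ev G mV mE V0 k})"

end

theory Submission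
  imports
    Defs
    "HOL-Computational_Algebra.Fundamental_Theorem_Algebra"
    "HOL-Combinatorics.List_Permutation"
begin

text \<open>By the Courant-Fischer principle, both order relations reduce to inequalities between the
  energies \<open>\<Sum>\<^sub>e |(d f)\<^sub>e|\<^sup>2 m\<^sub>e\<close>. Deleting the edges \<open>E0\<close> drops nonnegative terms and
  leaves edges on which the potential acts as a global phase. If \<open>f\<close> vanishes on \<open>V0\<close>, then on
  each edge of \<open>E0\<close> at most one endpoint contributes, so \<open>|(d f)\<^sub>e|\<close> does not see the
  potential and the two energies agree. The value \<open>2\<rho>\<^sub>\<infinity>\<close> bounds every eigenvalue by
  \<open>|a - b|\<^sup>2 \<le> 2(|a|\<^sup>2 + |b|\<^sup>2)\<close>.\<close>

section \<open>Spectral theory of symmetric operators on finite weighted sets\<close>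

text \<open>Gaussian elimination, by induction on the equations. It is stated for coefficient
  families over finite index sets because the dimension arguments below (orthogonal vectors,
  completeness, annihilating polynomials, the intersection in the Courant-Fischer argument) all take
  this form.\<close>

lemma underdetermined_system:
  fixes a :: "'i \<Rightarrow> 'j \<Rightarrow> 'c::field"
  assumes "finite I" "finite J" "card I < card J"
  obtains c where "\<exists>j\<in>J. c j \<noteq> 0" "\<And>i. i \<in> I \<Longrightarrow> (\<Sum>j\<in>J. a i j * c j) = 0"
proof -
  have "\<exists>c. (\<exists>j\<in>J. c j \<noteq> 0) \<and> (\<forall>i\<in>I. (\<Sum>j\<in>J. a i j * c j) = 0)"
    using assms
  proof (induction I arbitrary: J a rule: finite_induct)
    case empty
    then obtain j where "j \<in> J" by fastforce
    then show ?case by (intro exI[of _ "\<lambda>_. 1"]) auto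
  next
    case (insert i I)
    show ?case
    proof (cases "\<forall>j\<in>J. a i j = 0")
      case True
      have "card I < card J" using insert by simp
      from insert.IH[OF insert.prems(1) this, of a] True show ?thesis by auto
    next
      case False
      then obtain j0 where j0: "j0 \<in> J" "a i j0 \<noteq> 0" by auto
      define J' where "J' = J - {j0}"
      have J': "finite J'" "card I < card J'" "J = insert j0 J'" "j0 \<notin> J'"
        using insert j0 by (auto simp: J'_def)
      \<comment> \<open>Equation \<open>i\<close> is solved for the unknown \<open>j0\<close> and
        substituted into the others; the value at \<open>j0\<close> is restored below in
        \<open>c'\<close>.\<close>
      from insert.IH[OF J'(1,2), of "\<lambda>k j. a k j - a k j0 * a i j / a i j0"]
      obtain c where c: "\<exists>j\<in>J'. c j \<noteq> 0"
        and c0: "\<forall>k\<in>I. (\<Sum>j\<in>J'. (a k j - a k j0 * a i j / a i j0) * c j) = 0" by blast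
      define s where "s = (\<Sum>j\<in>J'. a i j * c j)"
      define c' where "c' = c(j0 := - s / a i j0)"
      have sum: "(\<Sum>j\<in>J. a k j * c' j) = (\<Sum>j\<in>J'. a k j * c j) - a k j0 * s / a i j0" for k
      proof -
        have "(\<Sum>j\<in>J'. a k j * c' j) = (\<Sum>j\<in>J'. a k j * c j)"
          by (intro sum.cong) (use J' in \<open>auto simp: c'_def\<close>)
        then show ?thesis using J' by (simp add: c'_def)
      qed
      have "(\<Sum>j\<in>J. a k j * c' j) = 0" if "k \<in> insert i I" for k
      proof (cases "k = i")
        case True
        then show ?thesis unfolding sum using j0 by (simp add: s_def)
      next
        case False
        have "(\<Sum>j\<in>J'. (a k j - a k j0 * a i j / a i j0) * c j)
            = (\<Sum>j\<in>J'. a k j * c j) - (a k j0 / a i j0) * s"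
          unfolding s_def sum_distrib_left sum_subtractf[symmetric]
          by (intro sum.cong) (auto simp: algebra_simps)
        then show ?thesis unfolding sum using c0 False that by auto
      qed
      moreover have "\<exists>j\<in>J. c' j \<noteq> 0" using c J' by (auto simp: c'_def)
      ultimately show ?thesis by blast
    qed
  qed
  then show ?thesis using that by blast
qed

section \<open>Linear combinations and the weighted inner product\<close>

lemma sum_cscale: "(\<Sum>i\<in>I. cscale (c i) (f i)) = (\<lambda>x. \<Sum>i\<in>I. c i * f i x)"
  by (induction I rule: infinite_finite_induct) (auto simp: cscale_def fun_eq_iff)

lemma ell2_subspace: "cfun.subspace (ell2 A)"
  by (auto simp: cfun.subspace_def ell2_def cscale_def)

lemma subspace_lincomb:
  assumes "cfun.subspace W" "\<And>i. i \<in> I \<Longrightarrow> f i \<in> W"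
  shows "(\<lambda>x. \<Sum>i\<in>I. c i * f i x) \<in> W"
  unfolding sum_cscale[symmetric]
  by (intro cfun.subspace_sum cfun.subspace_scale assms)

lemma ell2_lincomb:
  "(\<And>i. i \<in> I \<Longrightarrow> f i \<in> ell2 A) \<Longrightarrow> (\<lambda>x. \<Sum>i\<in>I. c i * f i x) \<in> ell2 A"
  by (rule subspace_lincomb[OF ell2_subspace])

lemma zero_ell2 [simp]: "0 \<in> ell2 A"
  by (simp add: ell2_def)

lemma ell2_mono: "A \<subseteq> B \<Longrightarrow> ell2 A \<subseteq> ell2 B"
  by (auto simp: ell2_def)

lemma ell2_diff: "f \<in> ell2 A \<Longrightarrow> g \<in> ell2 A \<Longrightarrow> f - g \<in> ell2 A"
  by (simp add: ell2_def)

lemma ell2_cscale: "f \<in> ell2 A \<Longrightarrow> cscale c f \<in> ell2 A"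
  by (simp add: ell2_def cscale_def)

lemma winner_lincomb_left:
  "winner A m (\<lambda>x. \<Sum>i\<in>I. c i * f i x) g = (\<Sum>i\<in>I. c i * winner A m (f i) g)"
  unfolding winner_def sum_distrib_left sum_distrib_right
  by (subst sum.swap) (simp add: mult_ac)

lemma winner_commute: "winner A m f g = cnj (winner A m g f)"
  by (simp add: winner_def mult_ac)

lemma winner_cscale_left: "winner A m (cscale c f) g = c * winner A m f g"
  by (simp add: winner_def cscale_def sum_distrib_left mult_ac)

lemma winner_cscale_right: "winner A m f (cscale c g) = cnj c * winner A m f g"
  by (simp add: winner_def cscale_def sum_distrib_left mult_ac)

lemma winner_diff_left: "winner A m (f - g) h = winner A m f h - winner A m g h"
  by (simp add: winner_def algebra_simps sum_subtractf)

lemma winner_add_left: "winner A m (f + g) h = winner A m f h + winner A m g h"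
  by (simp add: winner_def algebra_simps sum.distrib)

lemma winner_zero_left [simp]: "winner A m 0 h = 0"
  by (simp add: winner_def)

lemma winner_self: "winner A m f f = of_real (\<Sum>x\<in>A. (cmod (f x))\<^sup>2 * m x)"
  by (simp add: winner_def complex_norm_square del: of_real_power)

section \<open>Orthogonality and dimension over a finite weighted set\<close>

locale weighted_set =
  fixes A :: "'a set" and m :: "'a \<Rightarrow> real"
  assumes finite_A: "finite A" and weight_pos: "x \<in> A \<Longrightarrow> m x > 0"
begin

lemma winner_self_nonneg: "Re (winner A m f f) \<ge> 0"
  unfolding winner_self Re_complex_of_real
  by (intro sum_nonneg mult_nonneg_nonneg less_imp_le[OF weight_pos]) auto

lemma winner_self_eq_0:
  assumes "f \<in> ell2 A" "winner A m f f = 0"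
  shows "f = 0"
proof -
  have "(\<Sum>x\<in>A. (cmod (f x))\<^sup>2 * m x) = 0"
    using assms(2) unfolding winner_self of_real_eq_0_iff .
  then have "\<forall>x\<in>A. (cmod (f x))\<^sup>2 * m x = 0"
    by (subst (asm) sum_nonneg_eq_0_iff) (use finite_A weight_pos in \<open>auto simp: less_imp_le\<close>)
  then have "\<forall>x\<in>A. f x = 0" using weight_pos by fastforce
  then show ?thesis using assms(1) by (auto simp: ell2_def fun_eq_iff)
qed

lemma winner_self_pos:
  assumes "f \<in> ell2 A" "f \<noteq> 0"
  shows "Re (winner A m f f) > 0"
proof -
  have "winner A m f f = of_real (Re (winner A m f f))" by (simp only: winner_self Re_complex_of_real)
  then have "Re (winner A m f f) \<noteq> 0" using winner_self_eq_0[OF assms(1)] assms(2) by fastforce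
  then show ?thesis using winner_self_nonneg[of f] by linarith
qed

lemma winner_ext:
  assumes "f \<in> ell2 A" "g \<in> ell2 A" "\<And>h. h \<in> ell2 A \<Longrightarrow> winner A m f h = winner A m g h"
  shows "f = g"
proof -
  have "f - g = 0"
    by (rule winner_self_eq_0) (use assms in \<open>simp_all add: ell2_diff winner_diff_left\<close>)
  then show ?thesis by simp
qed

text \<open>The \<open>k\<close> orthogonality conditions are linear equations for the
  \<open>card A\<close> values of \<open>f\<close>.\<close>

lemma exists_orthogonal:
  assumes "k < card A"
  shows "\<exists>f\<in>ell2 A. f \<noteq> 0 \<and> (\<forall>i<k. winner A m f (\<phi> i) = 0)"
proof -
  obtain c where c: "\<exists>x\<in>A. c x \<noteq> 0"
    "\<And>i. i \<in> {..<k} \<Longrightarrow> (\<Sum>x\<in>A. (cnj (\<phi> i x) * of_real (m x)) * c x) = 0"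
    using underdetermined_system[of "{..<k}" A "\<lambda>i x. cnj (\<phi> i x) * of_real (m x)"]
      assms finite_A by auto
  have "winner A m (restr A c) (\<phi> i) = 0" if "i < k" for i
    using c(2)[of i] that by (simp add: winner_def restr_def mult_ac)
  moreover have "restr A c \<in> ell2 A" "restr A c \<noteq> 0"
    using c(1) by (auto simp: ell2_def restr_def fun_eq_iff)
  ultimately show ?thesis by blast
qed

text \<open>Otherwise there would be \<open>card A + 1\<close> nonzero, pairwise orthogonal
  functions on \<open>A\<close>. Any such number of functions satisfies a linear relation, and
  pairing the relation with each of them kills all its coefficients.\<close>

lemma orthogonal_to_basis_eq_0:
  fixes \<phi> :: "nat \<Rightarrow> 'a \<Rightarrow> complex"
  assumes "\<And>i. i < card A \<Longrightarrow> \<phi> i \<in> ell2 A"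
    and orth: "\<And>i j. i < card A \<Longrightarrow> j < card A \<Longrightarrow> winner A m (\<phi> i) (\<phi> j) = (if i = j then 1 else 0)"
    and g: "g \<in> ell2 A" "\<And>i. i < card A \<Longrightarrow> winner A m g (\<phi> i) = 0"
  shows "g = 0"
proof (rule ccontr)
  assume "g \<noteq> 0"
  define n where "n = card A"
  define \<psi> where "\<psi> = \<phi>(n := g)"
  obtain c where c: "\<exists>i\<in>{..n}. c i \<noteq> 0" "\<And>x. x \<in> A \<Longrightarrow> (\<Sum>i\<in>{..n}. \<psi> i x * c i) = 0"
    using underdetermined_system[of A "{..n}" "\<lambda>x i. \<psi> i x"] finite_A by (auto simp: n_def)
  have zero: "(\<Sum>i\<le>n. c i * winner A m (\<psi> i) h) = 0" for h
    unfolding winner_lincomb_left[symmetric] using c(2) by (simp add: winner_def mult_ac)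
  have orth': "winner A m (\<psi> i) (\<psi> j) = 0" if "i \<le> n" "j \<le> n" "i \<noteq> j" for i j
    using that orth[of i j] g(2) winner_commute[of A m "\<phi> i" g]
    by (auto simp: \<psi>_def n_def)
  have "c j = 0" if "j \<le> n" for j
  proof -
    have "(\<Sum>i\<le>n. c i * winner A m (\<psi> i) (\<psi> j)) = c j * winner A m (\<psi> j) (\<psi> j)"
      using that orth' by (subst sum.remove[of _ j]) (auto intro!: sum.neutral)
    moreover have "winner A m (\<psi> j) (\<psi> j) \<noteq> 0"
      using winner_self_eq_0[OF g(1)] \<open>g \<noteq> 0\<close> orth[of j j] that by (auto simp: \<psi>_def n_def)
    ultimately show ?thesis using zero[of "\<psi> j"] by simp
  qed
  with c(1) show False by auto
qed

text \<open>Serves both for the whole space and for single eigenspaces. Spanning is supplied by the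
  expansion \<open>ex\<close>; independence follows by pairing with \<open>\<phi> j\<close>.\<close>

lemma dim_orthonormal:
  fixes \<phi> :: "'i \<Rightarrow> 'a \<Rightarrow> complex"
  assumes "finite I"
    and orth: "\<And>i j. i \<in> I \<Longrightarrow> j \<in> I \<Longrightarrow> winner A m (\<phi> i) (\<phi> j) = (if i = j then 1 else 0)"
    and sub: "\<And>i. i \<in> I \<Longrightarrow> \<phi> i \<in> U"
    and ex: "\<And>f. f \<in> U \<Longrightarrow> f = (\<lambda>x. \<Sum>i\<in>I. c f i * \<phi> i x)"
  shows "cfun.dim U = card I"
proof (rule cfun.dim_unique[of "\<phi> ` I"])
  have inj: "inj_on \<phi> I"
  proof (rule inj_onI)
    fix i j assume ij: "i \<in> I" "j \<in> I" "\<phi> i = \<phi> j"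
    then show "i = j" using orth[of i j] orth[of i i] by (auto split: if_splits)
  qed
  show "\<phi> ` I \<subseteq> U" using sub by auto
  show "U \<subseteq> cfun.span (\<phi> ` I)"
  proof
    fix f assume "f \<in> U"
    have "f = (\<Sum>i\<in>I. cscale (c f i) (\<phi> i))" using ex[OF \<open>f \<in> U\<close>] by (simp add: sum_cscale)
    also have "\<dots> \<in> cfun.span (\<phi> ` I)"
      by (intro cfun.span_sum cfun.span_scale cfun.span_base imageI)
    finally show "f \<in> cfun.span (\<phi> ` I)" .
  qed
  show "cfun.independent (\<phi> ` I)"
  proof (rule cfun.independent_if_scalars_zero)
    fix u v assume u: "(\<Sum>v\<in>\<phi> ` I. cscale (u v) v) = 0" and "v \<in> \<phi> ` I"
    then obtain j where j: "j \<in> I" "v = \<phi> j" by auto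
    have "(\<lambda>x. \<Sum>i\<in>I. u (\<phi> i) * \<phi> i x) = 0"
      using u by (simp add: sum.reindex[OF inj] sum_cscale[symmetric])
    then have "0 = winner A m (\<lambda>x. \<Sum>i\<in>I. u (\<phi> i) * \<phi> i x) (\<phi> j)" by simp
    also have "\<dots> = (\<Sum>i\<in>I. u (\<phi> i) * (if i = j then 1 else 0))"
      unfolding winner_lincomb_left by (intro sum.cong) (use orth j in auto)
    also have "\<dots> = (\<Sum>i\<in>I. if i = j then u (\<phi> i) else 0)" by (intro sum.cong) auto
    also have "\<dots> = u v" using j \<open>finite I\<close> by simp
    finally show "u v = 0" by simp
  qed (use \<open>finite I\<close> in simp)
  show "card (\<phi> ` I) = card I" by (rule card_image[OF inj])
qed

end

section \<open>Orthonormal eigenvectors of symmetric operators\<close>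

locale symmetric_op = weighted_set A m for A :: "'a set" and m +
  fixes T :: "('a \<Rightarrow> complex) \<Rightarrow> ('a \<Rightarrow> complex)"
  assumes closed: "f \<in> ell2 A \<Longrightarrow> T f \<in> ell2 A"
    and symmetric: "f \<in> ell2 A \<Longrightarrow> g \<in> ell2 A \<Longrightarrow> winner A m (T f) g = winner A m f (T g)"
begin

text \<open>Linearity is a consequence of symmetry: moving \<open>T\<close> to the other argument
  shows that both sides have the same inner product with every function. The same reason gives
  \<open>T_diff\<close>.\<close>

lemma T_cscale: "f \<in> ell2 A \<Longrightarrow> T (cscale c f) = cscale c (T f)"
  by (rule winner_ext) (auto simp: closed ell2_cscale symmetric winner_cscale_left)

lemma T_diff: "f \<in> ell2 A \<Longrightarrow> g \<in> ell2 A \<Longrightarrow> T (f - g) = T f - T g"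
  by (rule winner_ext) (auto simp: closed ell2_diff symmetric winner_diff_left)

lemma T_pow_closed: "f \<in> ell2 A \<Longrightarrow> (T ^^ i) f \<in> ell2 A"
  by (induction i) (auto simp: closed)

text \<open>Powers of \<open>T\<close> commute with \<open>T - z\<close>. This lets a factor
  \<open>X - z\<close> be split off an annihilating polynomial.\<close>

lemma T_pow_shift:
  assumes "f \<in> ell2 A"
  shows "(T ^^ i) (T f - cscale z f) = (T ^^ Suc i) f - cscale z ((T ^^ i) f)"
proof (induction i)
  case (Suc i)
  have "(T ^^ Suc i) (T f - cscale z f) = T ((T ^^ Suc i) f - cscale z ((T ^^ i) f))"
    using Suc.IH by (simp only: funpow.simps comp_apply)
  also have "\<dots> = (T ^^ Suc (Suc i)) f - cscale z ((T ^^ Suc i) f)"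
    using assms T_diff[OF T_pow_closed[OF assms, of "Suc i"] ell2_cscale[OF T_pow_closed[OF assms]]]
    by (simp only: T_cscale T_pow_closed funpow.simps comp_apply)
  finally show ?case .
qed simp

text \<open>If \<open>p(T) w = 0\<close> and \<open>z\<close> is a root of \<open>p\<close>, then either \<open>w\<close> is an eigenvector for \<open>z\<close> or the
  nonzero vector \<open>(T - z) w\<close> is killed by a polynomial of smaller degree.\<close>

lemma eigenvector_of_annihilator:
  assumes W: "cfun.subspace W" "W \<subseteq> ell2 A" "\<And>f. f \<in> W \<Longrightarrow> T f \<in> W"
    and "w \<in> W" "w \<noteq> 0" "p \<noteq> 0" "degree p \<le> N"
    and "\<And>x. (\<Sum>i\<le>N. coeff p i * (T ^^ i) w x) = 0"
  shows "\<exists>v z. v \<in> W \<and> v \<noteq> 0 \<and> T v = cscale z v"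
  using assms(4-)
proof (induction N arbitrary: p w)
  case 0
  then have "coeff p 0 \<noteq> 0" using leading_coeff_0_iff[of p] by simp
  with 0 show ?case by (auto simp: fun_eq_iff)
next
  case (Suc N)
  show ?case
  proof (cases "degree p = 0")
    case True
    then obtain a where a: "p = [:a:]" by (rule degree_eq_zeroE)
    \<comment> \<open>A nonzero constant polynomial can only annihilate zero, contradicting
      \<open>w \<noteq> 0\<close>.\<close>
    have "w x = 0" for x
    proof -
      have "(\<Sum>i\<le>Suc N. coeff p i * (T ^^ i) w x) = a * w x"
        by (subst sum.remove[of _ 0]) (auto simp: a coeff_pCons split: nat.splits intro!: sum.neutral)
      with Suc.prems(5)[of x] a Suc.prems(3) show ?thesis by simp
    qed
    with Suc.prems show ?thesis by (auto simp: fun_eq_iff)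
  next
    case False
    then obtain z where "poly p z = 0"
      using fundamental_theorem_of_algebra[of p] by (auto simp: constant_degree)
    then obtain q where q: "p = [:- z, 1:] * q" by (auto simp: poly_eq_0_iff_dvd)
    have "q \<noteq> 0" using q Suc.prems by auto
    have "degree p = Suc (degree q)"
      using \<open>q \<noteq> 0\<close> by (subst q, subst degree_mult_eq) auto
    then have deg: "degree q \<le> N" using Suc.prems by simp
    have coeff_p: "coeff p i = coeff (pCons 0 q) i - z * coeff q i" for i
      by (simp add: q)
    define w' where "w' = T w - cscale z w"
    have wA: "w \<in> ell2 A" using Suc.prems W by auto
    have "(\<Sum>i\<le>N. coeff q i * (T ^^ i) w' x) = 0" for x
    proof -
      have "(\<Sum>i\<le>Suc N. coeff p i * (T ^^ i) w x)
          = (\<Sum>i\<le>Suc N. coeff (pCons 0 q) i * (T ^^ i) w x) - (\<Sum>i\<le>Suc N. z * coeff q i * (T ^^ i) w x)"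
        by (simp add: coeff_p algebra_simps sum_subtractf)
      also have "(\<Sum>i\<le>Suc N. coeff (pCons 0 q) i * (T ^^ i) w x) = (\<Sum>i\<le>N. coeff q i * (T ^^ Suc i) w x)"
        by (subst sum.atMost_Suc_shift) simp
      \<comment> \<open>The top term vanishes since \<open>degree q \<le> N\<close>.\<close>
      also have "(\<Sum>i\<le>Suc N. z * coeff q i * (T ^^ i) w x) = (\<Sum>i\<le>N. z * coeff q i * (T ^^ i) w x)"
        using deg by (simp add: coeff_eq_0)
      also have "(\<Sum>i\<le>N. coeff q i * (T ^^ Suc i) w x) - (\<Sum>i\<le>N. z * coeff q i * (T ^^ i) w x)
          = (\<Sum>i\<le>N. coeff q i * (T ^^ i) w' x)"
        unfolding w'_def T_pow_shift[OF wA] sum_subtractf[symmetric]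
        by (intro sum.cong) (auto simp: cscale_def algebra_simps)
      finally show ?thesis using Suc.prems(5)[of x] by simp
    qed
    moreover have "w' \<in> W"
      unfolding w'_def using Suc.prems W by (intro cfun.subspace_diff cfun.subspace_scale) auto
    moreover have "T w = cscale z w" if "w' = 0" using that by (simp add: w'_def)
    \<comment> \<open>Either \<open>w' = 0\<close> and \<open>w\<close> is an eigenvector for
      \<open>z\<close>, or the induction hypothesis applies to \<open>w'\<close> and
      \<open>q\<close>.\<close>
    ultimately show ?thesis
      using Suc.IH[of w' q, OF _ _ \<open>q \<noteq> 0\<close> deg] Suc.prems(1,2) by metis
  qed
qed

text \<open>The \<open>card A + 1\<close> iterates of \<open>w\<close> under \<open>T\<close>, from
  exponent 0 to \<open>card A\<close>, are linearly dependent, and a dependence is an annihilating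
  polynomial. An invariant subspace \<open>W\<close> is carried along so that the result applies
  inside orthogonal complements.\<close>

lemma exists_eigenvector:
  assumes W: "cfun.subspace W" "W \<subseteq> ell2 A" "\<And>f. f \<in> W \<Longrightarrow> T f \<in> W"
    and w: "w \<in> W" "w \<noteq> 0"
  obtains v z where "v \<in> W" "v \<noteq> 0" "T v = cscale z v"
proof -
  define n where "n = card A"
  obtain c where c: "\<exists>i\<in>{..n}. c i \<noteq> 0"
    "\<And>x. x \<in> A \<Longrightarrow> (\<Sum>i\<le>n. (T ^^ i) w x * c i) = 0"
    using underdetermined_system[of A "{..n}" "\<lambda>x i. (T ^^ i) w x"] finite_A by (auto simp: n_def)
  define p where "p = (\<Sum>i\<le>n. monom (c i) i)"
  have coeff_p: "coeff p i = (if i \<le> n then c i else 0)" for i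
    by (simp add: p_def coeff_sum)
  have "p \<noteq> 0" using c(1) coeff_p by (metis atMost_iff coeff_0)
  moreover have "degree p \<le> n" by (rule degree_le) (simp add: coeff_p)
  moreover have "(\<Sum>i\<le>n. coeff p i * (T ^^ i) w x) = 0" for x
  proof (cases "x \<in> A")
    case True
    with c(2)[of x] show ?thesis by (simp add: coeff_p mult.commute)
  next
    case False
    have "w \<in> ell2 A" using w W by auto
    then show ?thesis using False T_pow_closed[of w] by (auto simp: ell2_def intro!: sum.neutral)
  qed
  ultimately show ?thesis
    using eigenvector_of_annihilator[OF W w] that by blast
qed

lemma eigenvalue_real:
  assumes "v \<in> ell2 A" "v \<noteq> 0" "T v = cscale z v"
  shows "z \<in> \<real>"
proof -
  have "z * winner A m v v = cnj z * winner A m v v"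
    using symmetric[of v v] assms by (simp add: winner_cscale_left winner_cscale_right)
  then show ?thesis
    using winner_self_eq_0[OF assms(1)] assms(2) by (auto simp: Reals_cnj_iff)
qed

text \<open>Induction on \<open>k\<close>: the orthogonal complement of the eigenvectors found so
  far is invariant by symmetry and nonzero while \<open>k < card A\<close>, so it contains a further
  eigenvector. Its eigenvalue is real, and it is normalised to length one.\<close>

lemma orthonormal_eigenvectors:
  assumes "k \<le> card A"
  shows "\<exists>\<phi> \<mu>. (\<forall>i<k. \<phi> i \<in> ell2 A \<and> T (\<phi> i) = cscale (complex_of_real (\<mu> i)) (\<phi> i))
    \<and> (\<forall>i<k. \<forall>j<k. winner A m (\<phi> i) (\<phi> j) = (if i = j then 1 else 0))"
  using assms
proof (induction k)
  case 0
  show ?case by simp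
next
  case (Suc k)
  from Suc.IH[OF Suc_leD[OF Suc.prems]] obtain \<phi> \<mu> where IH:
    "\<forall>i<k. \<phi> i \<in> ell2 A \<and> T (\<phi> i) = cscale (complex_of_real (\<mu> i)) (\<phi> i)"
    "\<forall>i<k. \<forall>j<k. winner A m (\<phi> i) (\<phi> j) = (if i = j then 1 else 0)"
    by (elim exE conjE)
  note \<phi> = IH(1)[rule_format, THEN conjunct1] IH(1)[rule_format, THEN conjunct2] IH(2)[rule_format]
  define W where "W = {f \<in> ell2 A. \<forall>i<k. winner A m f (\<phi> i) = 0}"
  have W: "cfun.subspace W" "W \<subseteq> ell2 A"
  proof -
    show "cfun.subspace W"
      by (rule cfun.subspaceI) (simp_all only: W_def mem_Collect_eq winner_add_left winner_cscale_left
          ell2_cscale cfun.subspace_add[OF ell2_subspace] zero_ell2 winner_zero_left, simp_all)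
  qed (simp add: W_def)
  have T_W: "T f \<in> W" if "f \<in> W" for f
  proof -
    have "winner A m (T f) (\<phi> i) = 0" if "i < k" for i
      using \<open>f \<in> W\<close> symmetric[OF _ \<phi>(1)[OF that], of f] that
      by (simp add: W_def \<phi>(2) winner_cscale_right)
    then show ?thesis using that by (simp add: W_def closed)
  qed
  have "k < card A" using Suc.prems by simp
  then obtain w where w: "w \<in> W" "w \<noteq> 0"
    using exists_orthogonal[of k \<phi>] by (auto simp: W_def)
  obtain v z where v: "v \<in> W" "v \<noteq> 0" "T v = cscale z v"
    by (rule exists_eigenvector[OF W T_W w])
  have vA: "v \<in> ell2 A" using v by (simp add: W_def)
  obtain r where r: "z = of_real r" using eigenvalue_real[OF vA v(2,3)] Reals_cases by metis
  define s where "s = sqrt (Re (winner A m v v))"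
  have s: "s > 0" "winner A m v v = of_real (s\<^sup>2)"
    using winner_self_pos[OF vA v(2)] by (simp_all add: s_def winner_self del: of_real_sum)
  define u where "u = cscale (of_real (1 / s)) v"
  have uu: "winner A m u u = 1"
    using s by (simp add: u_def winner_cscale_left winner_cscale_right power2_eq_square)
  have u\<phi>: "winner A m u (\<phi> i) = 0" "winner A m (\<phi> i) u = 0" if "i < k" for i
  proof -
    have v\<phi>: "winner A m v (\<phi> i) = 0" using v(1) that by (simp add: W_def)
    then show "winner A m u (\<phi> i) = 0" by (simp add: u_def winner_cscale_left)
    show "winner A m (\<phi> i) u = 0"
      using v\<phi> by (subst winner_commute) (simp add: u_def winner_cscale_left)
  qed
  have uA: "u \<in> ell2 A" "T u = cscale (of_real r) u"
  proof -
    show "u \<in> ell2 A" unfolding u_def by (rule ell2_cscale[OF vA])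
    show "T u = cscale (of_real r) u"
      unfolding u_def T_cscale[OF vA] v(3) r by (rule cfun.scale_left_commute)
  qed
  define \<psi> where "\<psi> = \<phi>(k := u)"
  define \<nu> where "\<nu> = \<mu>(k := r)"
  have "\<psi> i \<in> ell2 A \<and> T (\<psi> i) = cscale (of_real (\<nu> i)) (\<psi> i)" if "i < Suc k" for i
    using \<phi>(1,2) uA that by (cases "i = k") (simp_all add: \<psi>_def \<nu>_def)
  moreover have "winner A m (\<psi> i) (\<psi> j) = (if i = j then 1 else 0)" if "i < Suc k" "j < Suc k" for i j
    using \<phi>(3) uu u\<phi> that by (cases "i = k"; cases "j = k") (simp_all add: \<psi>_def)
  ultimately show ?case by blast
qed

end

section \<open>Expansions in an orthonormal eigenbasis\<close>

locale eigenbasis = symmetric_op A m T for A :: "'a set" and m T +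
  fixes \<phi> :: "nat \<Rightarrow> 'a \<Rightarrow> complex" and \<mu> :: "nat \<Rightarrow> real"
  assumes \<phi>_ell2: "i < card A \<Longrightarrow> \<phi> i \<in> ell2 A"
    and T_\<phi>: "i < card A \<Longrightarrow> T (\<phi> i) = cscale (of_real (\<mu> i)) (\<phi> i)"
    and orthonormal: "i < card A \<Longrightarrow> j < card A \<Longrightarrow> winner A m (\<phi> i) (\<phi> j) = (if i = j then 1 else 0)"
begin

lemma winner_lincomb_\<phi>:
  assumes "I \<subseteq> {..<card A}" "j < card A"
  shows "winner A m (\<lambda>x. \<Sum>i\<in>I. c i * \<phi> i x) (\<phi> j) = (if j \<in> I then c j else 0)"
proof -
  have "finite I" using assms finite_subset by blast
  have "(\<Sum>i\<in>I. c i * winner A m (\<phi> i) (\<phi> j)) = (\<Sum>i\<in>I. if i = j then c i else 0)"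
    using assms by (intro sum.cong) (auto simp: orthonormal subset_iff)
  then show ?thesis using \<open>finite I\<close> by (simp add: winner_lincomb_left)
qed

lemma \<phi>_lincomb_ell2: "I \<subseteq> {..<card A} \<Longrightarrow> (\<lambda>x. \<Sum>i\<in>I. c i * \<phi> i x) \<in> ell2 A"
  by (intro ell2_lincomb \<phi>_ell2) auto

lemma expansion:
  assumes f: "f \<in> ell2 A"
  shows "f = (\<lambda>x. \<Sum>i<card A. winner A m f (\<phi> i) * \<phi> i x)" (is "f = ?g")
proof -
  have "f - ?g = 0"
  proof (rule orthogonal_to_basis_eq_0[of \<phi>])
    show "f - ?g \<in> ell2 A" by (rule ell2_diff[OF f \<phi>_lincomb_ell2]) simp
  qed (simp_all add: \<phi>_ell2 orthonormal winner_diff_left winner_lincomb_\<phi>)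
  then show ?thesis by simp
qed

lemma winner_T_\<phi>: "f \<in> ell2 A \<Longrightarrow> i < card A \<Longrightarrow> winner A m (T f) (\<phi> i) = of_real (\<mu> i) * winner A m f (\<phi> i)"
  by (simp add: symmetric \<phi>_ell2 T_\<phi> winner_cscale_right)

lemma parseval:
  assumes f: "f \<in> ell2 A"
  shows "winner A m f f = of_real (\<Sum>i<card A. (cmod (winner A m f (\<phi> i)))\<^sup>2)"
proof -
  have "winner A m f f = winner A m (\<lambda>x. \<Sum>i<card A. winner A m f (\<phi> i) * \<phi> i x) f"
    by (subst (1) expansion[OF f]) simp
  also have "\<dots> = (\<Sum>i<card A. winner A m f (\<phi> i) * cnj (winner A m f (\<phi> i)))"
    unfolding winner_lincomb_left using winner_commute[of A m f] by simp
  finally show ?thesis by (simp add: complex_norm_square del: of_real_power)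
qed

text \<open>\<open>T\<close> is diagonal in the coordinates \<open>winner A m f (\<phi> i)\<close>.
  Together with \<open>parseval\<close>, this presents the form as a combination of the eigenvalues
  with nonnegative weights summing to the squared norm.\<close>

lemma rayleigh:
  assumes f: "f \<in> ell2 A"
  shows "winner A m (T f) f = of_real (\<Sum>i<card A. \<mu> i * (cmod (winner A m f (\<phi> i)))\<^sup>2)"
proof -
  have "winner A m (T f) f = winner A m (\<lambda>x. \<Sum>i<card A. winner A m (T f) (\<phi> i) * \<phi> i x) f"
    by (subst (1) expansion[OF closed[OF f]]) simp
  also have "\<dots> = (\<Sum>i<card A. of_real (\<mu> i) * (winner A m f (\<phi> i) * cnj (winner A m f (\<phi> i))))"
    unfolding winner_lincomb_left using winner_commute[of A m f]
    by (intro sum.cong) (simp_all add: winner_T_\<phi> f)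
  finally show ?thesis by (simp add: complex_norm_square del: of_real_power)
qed

lemma op_dim_eq: "op_dim (ell2 A, T) = card A"
proof -
  have "cfun.dim (ell2 A) = card {..<card A}"
    by (rule dim_orthonormal[of _ \<phi> _ "\<lambda>f i. winner A m f (\<phi> i)"])
      (auto simp: orthonormal \<phi>_ell2 expansion[symmetric])
  then show ?thesis by (simp add: op_dim_def)
qed

text \<open>An eigenfunction for \<open>x\<close> has zero coefficient at every \<open>i\<close>
  with \<open>\<mu> i \<noteq> x\<close>, so the remaining \<open>\<phi> i\<close> form an
  orthonormal basis of the eigenspace.\<close>

lemma mult_ev_eq: "mult_ev (ell2 A, T) x = card {i. i < card A \<and> \<mu> i = x}"
  unfolding mult_ev_def
proof (rule dim_orthonormal[of _ \<phi> _ "\<lambda>f i. winner A m f (\<phi> i)"])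
  fix f assume "f \<in> eigenspace (ell2 A, T) x"
  then have f: "f \<in> ell2 A" "T f = cscale (of_real x) f" by (auto simp: eigenspace_def)
  have "winner A m f (\<phi> i) = 0" if "i < card A" "\<mu> i \<noteq> x" for i
    using winner_T_\<phi>[OF f(1) that(1)] that(2) f(2) by (simp add: winner_cscale_left)
  then have "(\<Sum>i<card A. winner A m f (\<phi> i) * \<phi> i y)
      = (\<Sum>i | i < card A \<and> \<mu> i = x. winner A m f (\<phi> i) * \<phi> i y)" for y
    by (intro sum.mono_neutral_right) auto
  then show "f = (\<lambda>y. \<Sum>i | i < card A \<and> \<mu> i = x. winner A m f (\<phi> i) * \<phi> i y)"
    using expansion[OF f(1)] by simp
qed (auto simp: orthonormal eigenspace_def \<phi>_ell2 T_\<phi>)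

text \<open>Both lists are sorted, and each value occurs in both as often as its multiplicity; a
  sorted list is determined by its multiset.\<close>

lemma eigenvalue_list_eq: "eigenvalue_list (ell2 A, T) = sort (map \<mu> [0..<card A])"
proof -
  let ?S = "(ell2 A, T)"
  have set_eq: "{x. mult_ev ?S x > 0} = \<mu> ` {..<card A}"
    by (auto simp: mult_ev_eq card_gt_0_iff)
  define xs where "xs = sorted_list_of_set {x. mult_ev ?S x > 0}"
  have xs: "set xs = \<mu> ` {..<card A}" "distinct xs" "sorted xs"
    by (simp_all add: xs_def set_eq)
  have sorted: "sorted (concat (map (\<lambda>x. replicate (k x) x) xs))" for k
    using xs(3) by (induction xs) (auto simp: sorted_append)
  have count: "count (mset (concat (map (\<lambda>x. replicate (k x) x) xs))) y = (if y \<in> set xs then k y else 0)"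
    for k y using xs(2) by (induction xs) auto
  have count_\<mu>: "count (mset (map \<mu> [0..<card A])) y = card {i. i < card A \<and> \<mu> i = y}" for y
  proof -
    have "count (mset (map \<mu> [0..<card A])) y = card {i. i < card A \<and> y = map \<mu> [0..<card A] ! i}"
      by (simp only: count_mset count_list_eq_length_filter length_filter_conv_card
          length_map length_upt diff_zero)
    also have "{i. i < card A \<and> y = map \<mu> [0..<card A] ! i} = {i. i < card A \<and> \<mu> i = y}"
      by auto
    finally show ?thesis .
  qed
  have "mset (eigenvalue_list ?S) = mset (map \<mu> [0..<card A])"
    unfolding eigenvalue_list_def xs_def[symmetric]
  proof (rule multiset_eqI)
    fix y
    have "card {i. i < card A \<and> \<mu> i = y} = 0" if "y \<notin> \<mu> ` {..<card A}"
      using that by (subst card_eq_0_iff) auto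
    then show "count (mset (concat (map (\<lambda>x. replicate (mult_ev ?S x) x) xs))) y
        = count (mset (map \<mu> [0..<card A])) y"
      unfolding count count_\<mu> xs(1) mult_ev_eq by presburger
  qed
  then show ?thesis
    using sorted unfolding eigenvalue_list_def xs_def[symmetric]
    by (intro properties_for_sort[symmetric])
qed

text \<open>If \<open>z\<close> differs from every \<open>\<mu> i\<close>, then \<open>T - z\<close>
  multiplies the \<open>i\<close>-th coefficient by the nonzero number \<open>\<mu> i - z\<close>
  and is therefore bijective.\<close>

lemma spectrum_subset: "spectrum (ell2 A, T) \<subseteq> (\<lambda>i. of_real (\<mu> i)) ` {..<card A}"
proof
  fix z assume z: "z \<in> spectrum (ell2 A, T)"
  show "z \<in> (\<lambda>i. complex_of_real (\<mu> i)) ` {..<card A}"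
  proof (rule ccontr)
    assume "\<not> ?thesis"
    then have ne: "of_real (\<mu> i) - z \<noteq> 0" if "i < card A" for i using that by auto
    let ?R = "\<lambda>f. T f - cscale z f"
    have R_\<phi>: "winner A m (?R f) (\<phi> i) = (of_real (\<mu> i) - z) * winner A m f (\<phi> i)"
      if "f \<in> ell2 A" "i < card A" for f i
      using that by (simp add: winner_diff_left winner_cscale_left winner_T_\<phi> algebra_simps)
    have R_closed: "?R f \<in> ell2 A" if "f \<in> ell2 A" for f
      using that by (intro ell2_diff closed ell2_cscale)
    have coeff_ext: "f = g" if "f \<in> ell2 A" "g \<in> ell2 A"
      "\<And>i. i < card A \<Longrightarrow> winner A m f (\<phi> i) = winner A m g (\<phi> i)" for f g
      by (subst expansion[OF that(1)], subst expansion[OF that(2)]) (simp add: that(3))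
    have "bij_betw ?R (ell2 A) (ell2 A)"
    proof (rule bij_betwI')
      fix f g assume fg: "f \<in> ell2 A" "g \<in> ell2 A"
      show "(?R f = ?R g) = (f = g)"
      proof
        assume "?R f = ?R g"
        then have "(of_real (\<mu> i) - z) * winner A m f (\<phi> i) = (of_real (\<mu> i) - z) * winner A m g (\<phi> i)"
          if "i < card A" for i using R_\<phi> fg that by metis
        then show "f = g" using ne by (intro coeff_ext fg) auto
      qed simp
    next
      fix f assume "f \<in> ell2 A"
      then show "?R f \<in> ell2 A" by (rule R_closed)
    next
      fix g assume g: "g \<in> ell2 A"
      \<comment> \<open>Dividing the coefficients gives the preimage of \<open>g\<close>, that is,
        the resolvent applied to \<open>g\<close>.\<close>
      define c where "c i = winner A m g (\<phi> i) / (of_real (\<mu> i) - z)" for i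
      define f where "f = (\<lambda>x. \<Sum>i<card A. c i * \<phi> i x)"
      have f: "f \<in> ell2 A" unfolding f_def by (rule \<phi>_lincomb_ell2) simp
      have f_\<phi>: "winner A m f (\<phi> i) = c i" if "i < card A" for i
        unfolding f_def using that by (simp add: winner_lincomb_\<phi>)
      have "g = ?R f"
        by (rule coeff_ext[OF g R_closed[OF f]]) (use ne in \<open>simp only: R_\<phi>[OF f] f_\<phi> c_def, simp\<close>)
      then show "\<exists>f\<in>ell2 A. g = ?R f" using f by blast
    qed
    then show False using z by (simp add: spectrum_def)
  qed
qed

end

section \<open>Eigenvalues in ascending order\<close>

context symmetric_op
begin

text \<open>An eigenbasis fixed once and for all whose order matches that of the eigenvalues. Basis
  vectors are numbered from 0 and eigenvalues from 1, hence \<open>Suc i\<close>.\<close>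

definition ev_basis :: "nat \<Rightarrow> 'a \<Rightarrow> complex" where
  "ev_basis = (SOME \<phi>. eigenbasis A m T \<phi> (\<lambda>i. ev (ell2 A, T) (Suc i)))"

lemma ev_eigenbasis: "eigenbasis A m T ev_basis (\<lambda>i. ev (ell2 A, T) (Suc i))"
  and ev_mono: "i \<le> j \<Longrightarrow> j < card A \<Longrightarrow> ev (ell2 A, T) (Suc i) \<le> ev (ell2 A, T) (Suc j)"
proof -
  obtain \<phi> \<mu> where "eigenbasis A m T \<phi> \<mu>"
    using orthonormal_eigenvectors[OF order_refl] symmetric_op_axioms
    unfolding eigenbasis_def eigenbasis_axioms_def by blast
  then interpret eigenbasis A m T \<phi> \<mu> .
  define xs where "xs = sort (map \<mu> [0..<card A])"
  have xs: "mset xs = mset (map \<mu> [0..<card A])" "length xs = card A" "sorted xs"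
    by (simp_all add: xs_def)
  have ev: "ev (ell2 A, T) (Suc i) = xs ! i" for i
    by (simp add: ev_def eigenvalue_list_eq xs_def)
  \<comment> \<open>Sorting permutes the eigenvalues by some \<open>p\<close>; permuting the
    eigenvectors by the same \<open>p\<close> keeps them an orthonormal eigenbasis.\<close>
  obtain p where p: "bij_betw p {..<card A} {..<card A}" "\<And>i. i < card A \<Longrightarrow> xs ! i = map \<mu> [0..<card A] ! p i"
    using permutation_Ex_bij[OF xs(1)] xs(2) by auto
  have p_less: "p i < card A" if "i < card A" for i using p(1) that by (auto dest: bij_betwE)
  have p_inj: "p i = p j \<longleftrightarrow> i = j" if "i < card A" "j < card A" for i j
    using p(1) that by (auto simp: bij_betw_def inj_on_def)
  have "eigenbasis A m T (\<phi> \<circ> p) (\<lambda>i. ev (ell2 A, T) (Suc i))"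
    by unfold_locales (simp_all add: \<phi>_ell2 T_\<phi> orthonormal p_less p_inj ev p(2))
  then show "eigenbasis A m T ev_basis (\<lambda>i. ev (ell2 A, T) (Suc i))"
    unfolding ev_basis_def by (rule someI[where P = "\<lambda>\<phi>. eigenbasis A m T \<phi> _"])
  show "i \<le> j \<Longrightarrow> j < card A \<Longrightarrow> ev (ell2 A, T) (Suc i) \<le> ev (ell2 A, T) (Suc j)"
    unfolding ev using xs by (simp add: sorted_nth_mono)
qed

sublocale ev_basis: eigenbasis A m T ev_basis "\<lambda>i. ev (ell2 A, T) (Suc i)"
  by (rule ev_eigenbasis)

text \<open>The form at a normalised eigenvector equals its eigenvalue.\<close>

lemma ev_le_bound:
  assumes "\<And>f. f \<in> ell2 A \<Longrightarrow> Re (winner A m (T f) f) \<le> b * Re (winner A m f f)" "i < card A"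
  shows "ev (ell2 A, T) (Suc i) \<le> b"
  using assms(1)[OF ev_basis.\<phi>_ell2[OF assms(2)]] assms(2)
  by (simp add: ev_basis.T_\<phi> winner_cscale_left ev_basis.orthonormal)

end

section \<open>Comparison of eigenvalues through quadratic forms\<close>

lemma winner_subset:
  assumes "finite A" "A' \<subseteq> A" "f \<in> ell2 A'"
  shows "winner A m f g = winner A' m f g"
  unfolding winner_def using assms by (intro sum.mono_neutral_right) (auto simp: ell2_def)

text \<open>The Courant-Fischer argument: the span of the first \<open>k\<close> eigenfunctions of \<open>T'\<close> meets the
  orthogonal complement of the first \<open>k - 1\<close> eigenfunctions of \<open>T\<close>.\<close>

lemma spec_le_of_forms:
  assumes "symmetric_op A m T" "symmetric_op A' m T'" "A' \<subseteq> A"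
    and le: "\<And>f. f \<in> ell2 A' \<Longrightarrow> Re (winner A m (T f) f) \<le> Re (winner A' m (T' f) f)"
  shows "(ell2 A, T) \<preceq> (ell2 A', T')"
proof -
  interpret S: symmetric_op A m T by fact
  interpret S': symmetric_op A' m T' by fact
  let ?\<phi> = S.ev_basis and ?\<phi>' = S'.ev_basis
  let ?\<mu> = "\<lambda>i. ev (ell2 A, T) (Suc i)" and ?\<mu>' = "\<lambda>i. ev (ell2 A', T') (Suc i)"
  have card_le: "card A' \<le> card A" using S.finite_A assms(3) by (rule card_mono)
  have ev_le: "?\<mu> k \<le> ?\<mu>' k" if k: "k < card A'" for k
  proof -
    \<comment> \<open>There are \<open>k\<close> orthogonality conditions for \<open>k + 1\<close>
      coefficients, as \<open>k\<close> counts from 0 here.\<close>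
    obtain c where c: "\<exists>j\<in>{..k}. c j \<noteq> 0"
      "\<And>i. i \<in> {..<k} \<Longrightarrow> (\<Sum>j\<le>k. winner A m (?\<phi>' j) (?\<phi> i) * c j) = 0"
      using underdetermined_system[of "{..<k}" "{..k}" "\<lambda>i j. winner A m (?\<phi>' j) (?\<phi> i)"] by auto
    define f where "f = (\<lambda>x. \<Sum>j\<le>k. c j * ?\<phi>' j x)"
    have k_sub: "{..k} \<subseteq> {..<card A'}" using k by auto
    have f': "f \<in> ell2 A'" unfolding f_def by (rule S'.ev_basis.\<phi>_lincomb_ell2[OF k_sub])
    then have f: "f \<in> ell2 A" using ell2_mono[OF assms(3)] by auto
    have coeff': "winner A' m f (?\<phi>' j) = (if j \<le> k then c j else 0)" if "j < card A'" for j
      unfolding f_def using S'.ev_basis.winner_lincomb_\<phi>[OF k_sub that] by simp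
    have coeff: "winner A m f (?\<phi> i) = 0" if "i < k" for i
      using c(2)[of i] that by (simp add: f_def winner_lincomb_left mult.commute)
    have "f \<noteq> 0"
    proof
      assume "f = 0"
      then have "c j = 0" if "j \<le> k" for j using coeff'[of j] that k by simp
      with c(1) show False by auto
    qed
    define N where "N = Re (winner A m f f)"
    have "N > 0" unfolding N_def by (rule S.winner_self_pos[OF f \<open>f \<noteq> 0\<close>])
    have N: "N = (\<Sum>i<card A. (cmod (winner A m f (?\<phi> i)))\<^sup>2)"
      "N = (\<Sum>i<card A'. (cmod (winner A' m f (?\<phi>' i)))\<^sup>2)"
      using S.ev_basis.parseval[OF f] S'.ev_basis.parseval[OF f']
        winner_subset[OF S.finite_A assms(3) f', of m f]
      by (simp_all add: N_def del: of_real_sum)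
    \<comment> \<open>The coefficients of \<open>f\<close> below \<open>k\<close> vanish, and from
      \<open>k\<close> on the eigenvalues of \<open>T\<close> are at least
      \<open>?\<mu> k\<close>.\<close>
    have "?\<mu> k * N \<le> (\<Sum>i<card A. ?\<mu> i * (cmod (winner A m f (?\<phi> i)))\<^sup>2)"
      unfolding N(1) sum_distrib_left
    proof (rule sum_mono)
      fix i assume "i \<in> {..<card A}"
      then show "?\<mu> k * (cmod (winner A m f (?\<phi> i)))\<^sup>2 \<le> ?\<mu> i * (cmod (winner A m f (?\<phi> i)))\<^sup>2"
        using coeff[of i] S.ev_mono[of k i] by (cases "i < k") (simp_all add: mult_right_mono)
    qed
    also have "\<dots> = Re (winner A m (T f) f)" by (simp only: S.ev_basis.rayleigh[OF f] Re_complex_of_real)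
    also have "\<dots> \<le> Re (winner A' m (T' f) f)" by (rule le[OF f'])
    also have "\<dots> = (\<Sum>i<card A'. ?\<mu>' i * (cmod (winner A' m f (?\<phi>' i)))\<^sup>2)"
      by (simp only: S'.ev_basis.rayleigh[OF f'] Re_complex_of_real)
    \<comment> \<open>Dually, \<open>f\<close> has no \<open>T'\<close>-coefficients above
      \<open>k\<close>, and up to \<open>k\<close> the eigenvalues of \<open>T'\<close> are at most
      \<open>?\<mu>' k\<close>.\<close>
    also have "\<dots> \<le> ?\<mu>' k * N"
      unfolding N(2) sum_distrib_left
    proof (rule sum_mono)
      fix i assume "i \<in> {..<card A'}"
      then show "?\<mu>' i * (cmod (winner A' m f (?\<phi>' i)))\<^sup>2 \<le> ?\<mu>' k * (cmod (winner A' m f (?\<phi>' i)))\<^sup>2"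
        using coeff'[of i] S'.ev_mono[of i k] k by (cases "i \<le> k") (simp_all add: mult_right_mono)
    qed
    finally show ?thesis using \<open>N > 0\<close> by simp
  qed
  show ?thesis
    unfolding spec_le_def S.ev_basis.op_dim_eq S'.ev_basis.op_dim_eq
  proof (intro conjI ballI)
    fix k assume "k \<in> {1..card A'}"
    then show "ev (ell2 A, T) k \<le> ev (ell2 A', T') k" using ev_le[of "k - 1"] by (cases k) auto
  qed (rule card_le)
qed

section \<open>Adjoints and the operators built from them\<close>

text \<open>\<open>K\<close> is the kernel of the derivative, so that \<open>cnj (K e x)\<close> gives the adjoint.\<close>

locale kernel_operator = weighted_set A m for A :: "'a set" and m +
  fixes B :: "'b set" and m' :: "'b \<Rightarrow> real"
    and D :: "('a \<Rightarrow> complex) \<Rightarrow> 'b \<Rightarrow> complex" and K :: "'b \<Rightarrow> 'a \<Rightarrow> complex"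
  assumes kernel: "f \<in> ell2 A \<Longrightarrow> e \<in> B \<Longrightarrow> D f e = (\<Sum>x\<in>A. K e x * f x)"
begin

text \<open>Resolves the definite description: an explicit function has the defining property, and
  positivity of the weights makes it unique.\<close>

lemma wadjoint:
  shows wadjoint_ell2: "wadjoint A m B m' D \<eta> \<in> ell2 A"
    and winner_wadjoint: "f \<in> ell2 A \<Longrightarrow> winner A m f (wadjoint A m B m' D \<eta>) = winner B m' (D f) \<eta>"
proof -
  let ?P = "\<lambda>g. g \<in> ell2 A \<and> (\<forall>f\<in>ell2 A. winner B m' (D f) \<eta> = winner A m f g)"
  \<comment> \<open>The conjugate transpose of \<open>K\<close>, with the weight \<open>m'\<close>
    of the source space as a factor and the weight \<open>m\<close> of the target space divided
    out.\<close>
  define g where "g = restr A (\<lambda>x. (\<Sum>e\<in>B. cnj (K e x) * \<eta> e * of_real (m' e)) / of_real (m x))"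
  have "?P g"
  proof (intro conjI ballI)
    fix f assume f: "f \<in> ell2 A"
    have "winner A m f g = (\<Sum>x\<in>A. \<Sum>e\<in>B. K e x * f x * cnj (\<eta> e) * of_real (m' e))"
      unfolding winner_def
    proof (rule sum.cong)
      fix x assume "x \<in> A"
      then have "m x \<noteq> 0" using weight_pos by force
      with \<open>x \<in> A\<close> have "cnj (g x) * of_real (m x) = (\<Sum>e\<in>B. K e x * cnj (\<eta> e) * of_real (m' e))"
        by (simp add: g_def restr_def)
      then show "f x * cnj (g x) * of_real (m x) = (\<Sum>e\<in>B. K e x * f x * cnj (\<eta> e) * of_real (m' e))"
        by (simp add: mult.assoc sum_distrib_left mult.left_commute)
    qed simp
    also have "\<dots> = (\<Sum>e\<in>B. \<Sum>x\<in>A. K e x * f x * cnj (\<eta> e) * of_real (m' e))"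
      by (rule sum.swap)
    also have "\<dots> = winner B m' (D f) \<eta>"
      unfolding winner_def by (intro sum.cong) (simp_all add: kernel f sum_distrib_right)
    finally show "winner B m' (D f) \<eta> = winner A m f g" ..
  qed (simp add: g_def ell2_def restr_def)
  moreover have "g1 = g2" if "?P g1" "?P g2" for g1 g2
    by (rule winner_ext) (use that winner_commute[of A m] in metis)+
  ultimately have "?P (wadjoint A m B m' D \<eta>)"
    unfolding wadjoint_def by (intro theI[of ?P]) blast+
  then show "wadjoint A m B m' D \<eta> \<in> ell2 A"
    "f \<in> ell2 A \<Longrightarrow> winner A m f (wadjoint A m B m' D \<eta>) = winner B m' (D f) \<eta>"
    by auto
qed

abbreviation gram :: "('a \<Rightarrow> complex) \<Rightarrow> 'a \<Rightarrow> complex" where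
  "gram f \<equiv> wadjoint A m B m' D (D f)"

lemma winner_gram: "g \<in> ell2 A \<Longrightarrow> winner A m (gram f) g = winner B m' (D f) (D g)"
  by (subst (1 2) winner_commute) (simp add: winner_wadjoint)

text \<open>The quadratic form is the energy, so comparing spectra becomes comparing sums over
  edges.\<close>

lemma form_gram: "f \<in> ell2 A \<Longrightarrow> Re (winner A m (gram f) f) = (\<Sum>e\<in>B. (cmod (D f e))\<^sup>2 * m' e)"
  by (simp only: winner_gram winner_self Re_complex_of_real)

lemma symmetric_op_gram: "symmetric_op A m gram"
  by unfold_locales (auto simp: wadjoint_ell2 winner_gram winner_wadjoint)

end

section \<open>Energies of magnetic Laplacians\<close>

text \<open>The two endpoints enter through separate conditionals, so a loop collects both phases at
  its vertex. An endpoint outside \<open>A\<close> contributes nothing because \<open>f\<close>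
  vanishes there; this makes the formula usable after virtualising vertices.\<close>

lemma deriv_pot_kernel:
  assumes "finite A" "f \<in> ell2 A" "e \<in> arcs G"
  shows "deriv_pot G \<alpha> f e = (\<Sum>x\<in>A. ((if x = head G e then exp (\<i> * of_real (\<alpha> e) / 2) else 0)
    - (if x = tail G e then exp (- \<i> * of_real (\<alpha> e) / 2) else 0)) * f x)"
proof -
  have delta: "(\<Sum>x\<in>A. (if x = v then a else 0) * f x) = a * f v" for v a
  proof -
    have "(\<Sum>x\<in>A. (if x = v then a else 0) * f x) = (\<Sum>x\<in>A. if x = v then a * f x else 0)"
      by (intro sum.cong) auto
    then show ?thesis using assms(1,2) by (auto simp: ell2_def)
  qed
  show ?thesis
    using assms(3) by (simp only: left_diff_distrib sum_subtractf delta) (simp add: deriv_pot_def restr_def)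
qed

lemma deriv_pot_del_edges:
  "e \<in> arcs G - E0 \<Longrightarrow> deriv_pot (del_edges G E0) \<alpha> f e = deriv_pot G \<alpha> f e"
  by (simp add: deriv_pot_def del_edges_def restr_def)

lemma vertex_virt_deriv_eq:
  assumes "f \<in> ell2 (verts G - V0)" "e \<in> arcs G - edges_within G V0"
  shows "vertex_virt_deriv G V0 \<beta> f e = deriv_pot G \<beta> f e"
proof -
  have "restr (verts G - V0) f = f" using assms(1) by (auto simp: restr_def ell2_def fun_eq_iff)
  then show ?thesis using assms(2) by (simp add: vertex_virt_deriv_def restr_def)
qed

lemma norm_phase: "cmod (exp (\<i> * of_real a / 2)) = 1" "cmod (exp (- \<i> * of_real a / 2)) = 1"
  by simp_all

text \<open>If \<open>\<alpha> e\<close> is a multiple of \<open>2 * pi\<close>, the two half-angle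
  phases differ by the factor \<open>exp (- \<i> * of_real (\<alpha> e))\<close>, which is 1. They
  therefore coincide, and the common phase drops out of the modulus.\<close>

lemma cmod_deriv_pot_eq_if_potential_0:
  assumes "[\<alpha> e = 0] (rmod (2 * pi))"
  shows "cmod (deriv_pot G \<alpha> f e) = cmod (deriv_pot G (\<lambda>_. 0) f e)"
proof -
  obtain n where n: "0 = \<alpha> e + of_int n * (2 * pi)" using assms unfolding rcong_altdef by blast
  let ?u = "exp (\<i> * of_real (\<alpha> e) / 2)"
  have "- \<i> * of_real (\<alpha> e) = complex_of_real (2 * of_int n * pi) * \<i>"
    using n by (simp add: algebra_simps eq_neg_iff_add_eq_0 [symmetric])
  then have "exp (- \<i> * of_real (\<alpha> e)) = 1" by (simp only: exp_integer_2pi Ints_of_int)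
  moreover have "exp (- \<i> * of_real (\<alpha> e) / 2) = ?u * exp (- \<i> * of_real (\<alpha> e))"
    by (simp flip: exp_add)
  ultimately have u: "exp (- \<i> * of_real (\<alpha> e) / 2) = ?u" by (simp only: mult_1_right)
  have "deriv_pot G \<alpha> f e = ?u * deriv_pot G (\<lambda>_. 0) f e"
    unfolding deriv_pot_def restr_def u by (simp add: algebra_simps)
  then show ?thesis by (simp only: norm_mult norm_phase mult_1_left)
qed

lemma cmod_deriv_pot_eq_if_vanishing:
  assumes "f (head G e) = 0 \<or> f (tail G e) = 0"
  shows "cmod (deriv_pot G \<alpha> f e) = cmod (deriv_pot G \<beta> f e)"
  using assms by (auto simp: deriv_pot_def restr_def norm_mult simp del: mult_minus_left)

lemma cmod_deriv_pot_le:
  "e \<in> arcs G \<Longrightarrow> (cmod (deriv_pot G \<alpha> f e))\<^sup>2 \<le> 2 * ((cmod (f (head G e)))\<^sup>2 + (cmod (f (tail G e)))\<^sup>2)"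
proof -
  assume e: "e \<in> arcs G"
  let ?h = "cmod (f (head G e))" and ?t = "cmod (f (tail G e))"
  have "cmod (deriv_pot G \<alpha> f e) \<le> ?h + ?t"
    using e norm_triangle_ineq4[of "exp (\<i> * of_real (\<alpha> e) / 2) * f (head G e)"
        "exp (- \<i> * of_real (\<alpha> e) / 2) * f (tail G e)"]
    by (simp only: norm_mult norm_phase deriv_pot_def restr_def if_True mult_1_left)
  then have "(cmod (deriv_pot G \<alpha> f e))\<^sup>2 \<le> (?h + ?t)\<^sup>2" by (intro power_mono) auto
  also have "\<dots> \<le> 2 * (?h\<^sup>2 + ?t\<^sup>2)"
    using zero_le_power2[of "?h - ?t"] by (simp add: power2_sum power2_diff)
  finally show ?thesis .
qed

context weighted_graph
begin

lemma weighted_set_subset: "A \<subseteq> verts G \<Longrightarrow> weighted_set A mV"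
  using finite_verts vertex_weight_pos by (auto simp: weighted_set_def finite_subset)

text \<open>Summing the edgewise bound and collecting the terms by endpoint leaves at each vertex
  \<open>v\<close> the factor \<open>rel_weight G mV mE v * mV v\<close>.\<close>

lemma form_le_max_rel_weight:
  "(\<Sum>e\<in>arcs G. (cmod (deriv_pot G \<alpha> f e))\<^sup>2 * mE e)
    \<le> 2 * max_rel_weight G mV mE * (\<Sum>v\<in>verts G. (cmod (f v))\<^sup>2 * mV v)"
proof -
  let ?q = "\<lambda>v. (cmod (f v))\<^sup>2"
  \<comment> \<open>Applied with \<open>d\<close> the head and the tail map, so a loop is counted
    twice, just as in \<open>rel_weight\<close>.\<close>
  have regroup: "(\<Sum>e\<in>arcs G. ?q (d e) * mE e) = (\<Sum>v\<in>verts G. ?q v * (\<Sum>e | e \<in> arcs G \<and> d e = v. mE e))"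
    if "d ` arcs G \<subseteq> verts G" for d
    unfolding sum_distrib_left
    by (subst sum.group[OF finite_arcs finite_verts that, symmetric]) (intro sum.cong, auto)
  have "(\<Sum>e\<in>arcs G. (cmod (deriv_pot G \<alpha> f e))\<^sup>2 * mE e)
      \<le> (\<Sum>e\<in>arcs G. 2 * (?q (head G e) + ?q (tail G e)) * mE e)"
    by (intro sum_mono mult_right_mono cmod_deriv_pot_le less_imp_le[OF edge_weight_pos])
  also have "\<dots> = 2 * ((\<Sum>e\<in>arcs G. ?q (head G e) * mE e) + (\<Sum>e\<in>arcs G. ?q (tail G e) * mE e))"
    by (simp only: sum.distrib[symmetric] sum_distrib_left) (simp add: algebra_simps)
  also have "\<dots> = 2 * (\<Sum>v\<in>verts G. rel_weight G mV mE v * (?q v * mV v))"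
  proof -
    have "rel_weight G mV mE v * (?q v * mV v) = ?q v * (\<Sum>e | e \<in> arcs G \<and> head G e = v. mE e)
        + ?q v * (\<Sum>e | e \<in> arcs G \<and> tail G e = v. mE e)" if "v \<in> verts G" for v
      using vertex_weight_pos[OF that] by (simp add: rel_weight_def field_simps)
    then show ?thesis by (subst (1 2) regroup) (auto simp: sum.distrib)
  qed
  \<comment> \<open>The maximum is compared only at actual vertices; without vertices both sums are
    empty.\<close>
  also have "\<dots> \<le> 2 * (\<Sum>v\<in>verts G. max_rel_weight G mV mE * (?q v * mV v))"
    unfolding max_rel_weight_def using vertex_weight_pos
    by (intro mult_left_mono sum_mono mult_right_mono Max_ge)
      (auto simp: finite_verts less_imp_le)
  finally show ?thesis by (simp add: sum_distrib_left mult_ac)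
qed

end

section \<open>The two order relations and the location of the spectrum\<close>

theorem theorem3p14:
  fixes G :: "('v, 'e) pre_digraph"
    and mV :: "'v \<Rightarrow> real" and mE :: "'e \<Rightarrow> real"
    and E0 :: "'e set" and V0 :: "'v set" and \<alpha> :: "'e \<Rightarrow> real"
  assumes "weighted_graph G mV mE"
    and "E0 \<subseteq> arcs G" and "V0 \<subseteq> verts G"
    and "in_neighbourhood G V0 E0"
    and "supported_in G \<alpha> E0"
  shows "edge_virt_laplacian G mV mE E0 \<preceq> laplacian G mV mE \<alpha>
    \<and> laplacian G mV mE \<alpha> \<preceq> vertex_virt_laplacian G mV mE V0 (\<lambda>_. 0)
    \<and> spectrum (laplacian G mV mE \<alpha>) \<subseteq> complex_of_real ` bracketing_set G mV mE E0 V0"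
proof -
  interpret weighted_graph G mV mE by fact
  \<comment> \<open>One kernel formula describes all three derivatives; only the potential and the
    sets of vertices and edges change.\<close>
  define K where "K \<beta> e x = (if x = head G e then exp (\<i> * complex_of_real (\<beta> e) / 2) else 0)
    - (if x = tail G e then exp (- \<i> * of_real (\<beta> e) / 2) else 0)" for \<beta> e x
  let ?G' = "del_edges G E0" and ?o = "\<lambda>_. 0 :: real"
  let ?V = "verts G - V0" and ?E = "arcs G - edges_within G V0"
  interpret V: weighted_set "verts G" mV by (rule weighted_set_subset) simp
  interpret V': weighted_set ?V mV by (rule weighted_set_subset) auto
  have arcs': "arcs ?G' = arcs G - E0" and verts': "verts ?G' = verts G"
    by (simp_all add: del_edges_def)
  interpret L: kernel_operator "verts G" mV "arcs G" mE "deriv_pot G \<alpha>" "K \<alpha>"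
    by unfold_locales (simp only: K_def deriv_pot_kernel[OF finite_verts])
  interpret M: kernel_operator "verts G" mV "arcs ?G'" mE "deriv_pot ?G' ?o" "K ?o"
    by unfold_locales (simp only: arcs' deriv_pot_del_edges, simp only: K_def deriv_pot_kernel[OF finite_verts] Diff_iff)
  interpret P: kernel_operator ?V mV ?E mE "vertex_virt_deriv G V0 ?o" "K ?o"
    by unfold_locales (simp only: vertex_virt_deriv_eq, simp only: K_def deriv_pot_kernel[OF V'.finite_A] Diff_iff)
  interpret LS: symmetric_op "verts G" mV L.gram by (rule L.symmetric_op_gram)
  have lap: "laplacian G mV mE \<alpha> = (ell2 (verts G), L.gram)"
    "edge_virt_laplacian G mV mE E0 = (ell2 (verts G), M.gram)"
    "vertex_virt_laplacian G mV mE V0 ?o = (ell2 ?V, P.gram)"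
    by (simp_all add: laplacian_def edge_virt_laplacian_def vertex_virt_laplacian_def verts')
  have eq0: "cmod (deriv_pot G \<alpha> f e) = cmod (deriv_pot G ?o f e)" if "e \<in> arcs G - E0" for f e
    using assms(5) that by (intro cmod_deriv_pot_eq_if_potential_0) (auto simp: supported_in_def)

  have lower: "(ell2 (verts G), M.gram) \<preceq> (ell2 (verts G), L.gram)"
  proof (rule spec_le_of_forms[OF M.symmetric_op_gram L.symmetric_op_gram order_refl])
    fix f assume f: "f \<in> ell2 (verts G)"
    have "(\<Sum>e\<in>arcs ?G'. (cmod (deriv_pot ?G' ?o f e))\<^sup>2 * mE e)
        = (\<Sum>e\<in>arcs G - E0. (cmod (deriv_pot G \<alpha> f e))\<^sup>2 * mE e)"
      unfolding arcs' by (intro sum.cong) (simp_all only: deriv_pot_del_edges eq0)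
    also have "\<dots> \<le> (\<Sum>e\<in>arcs G. (cmod (deriv_pot G \<alpha> f e))\<^sup>2 * mE e)"
      using edge_weight_pos by (intro sum_mono2 finite_arcs) (auto simp: less_imp_le)
    finally show "Re (winner (verts G) mV (M.gram f) f) \<le> Re (winner (verts G) mV (L.gram f) f)"
      using f by (simp only: L.form_gram M.form_gram)
  qed

  have upper: "(ell2 (verts G), L.gram) \<preceq> (ell2 ?V, P.gram)"
  proof (rule spec_le_of_forms[OF L.symmetric_op_gram P.symmetric_op_gram Diff_subset])
    fix f assume f: "f \<in> ell2 ?V"
    then have f_verts: "f \<in> ell2 (verts G)" using ell2_mono[of ?V "verts G"] by auto
    have f0: "f v = 0" if "v \<in> V0" for v using f that by (simp add: ell2_def)
    \<comment> \<open>Edges with both endpoints in \<open>V0\<close> carry no energy since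
      \<open>f\<close> vanishes at both ends.\<close>
    have "(\<Sum>e\<in>arcs G. (cmod (deriv_pot G \<alpha> f e))\<^sup>2 * mE e)
        = (\<Sum>e\<in>?E. (cmod (deriv_pot G \<alpha> f e))\<^sup>2 * mE e)"
      by (intro sum.mono_neutral_right finite_arcs)
        (auto simp: edges_within_def deriv_pot_def restr_def f0)
    also have "\<dots> = (\<Sum>e\<in>?E. (cmod (vertex_virt_deriv G V0 ?o f e))\<^sup>2 * mE e)"
    proof (rule sum.cong)
      fix e assume e: "e \<in> ?E"
      \<comment> \<open>On \<open>E0\<close> the neighbourhood condition gives an endpoint where
        \<open>f\<close> vanishes; elsewhere the potential is zero modulo
        \<open>2 * pi\<close>.\<close>
      have "cmod (deriv_pot G \<alpha> f e) = cmod (deriv_pot G ?o f e)"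
      proof (cases "e \<in> E0")
        case True
        then have "f (head G e) = 0 \<or> f (tail G e) = 0"
          using assms(4) f0 by (auto simp: in_neighbourhood_def)
        then show ?thesis by (rule cmod_deriv_pot_eq_if_vanishing)
      qed (use e eq0 in simp)
      then show "(cmod (deriv_pot G \<alpha> f e))\<^sup>2 * mE e = (cmod (vertex_virt_deriv G V0 ?o f e))\<^sup>2 * mE e"
        by (simp only: vertex_virt_deriv_eq[OF f e])
    qed simp
    finally show "Re (winner (verts G) mV (L.gram f) f) \<le> Re (winner ?V mV (P.gram f) f)"
      using f f_verts by (simp only: L.form_gram P.form_gram order_refl)
  qed

  have "spectrum (ell2 (verts G), L.gram) \<subseteq> complex_of_real ` bracketing_set G mV mE E0 V0"
  proof
    fix z assume "z \<in> spectrum (ell2 (verts G), L.gram)"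
    then obtain i where i: "i < card (verts G)" "z = of_real (ev (ell2 (verts G), L.gram) (Suc i))"
      using LS.ev_basis.spectrum_subset by blast
    interpret MS: symmetric_op "verts G" mV M.gram by (rule M.symmetric_op_gram)
    interpret PS: symmetric_op ?V mV P.gram by (rule P.symmetric_op_gram)
    \<comment> \<open>Identifies the threshold in \<open>upper_ev\<close> with the dimension after
      virtualising \<open>V0\<close>.\<close>
    have card_V: "card ?V = card (verts G) - card V0"
      using finite_subset[OF assms(3) finite_verts] assms(3) by (rule card_Diff_subset)
    have "ev (ell2 (verts G), M.gram) (Suc i) \<le> ev (ell2 (verts G), L.gram) (Suc i)"
      using lower i by (simp add: spec_le_def LS.ev_basis.op_dim_eq)
    moreover have "ev (ell2 (verts G), L.gram) (Suc i) \<le> upper_ev G mV mE V0 (Suc i)"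
    proof (cases "Suc i \<le> card ?V")
      case True
      then show ?thesis
        using upper card_V by (simp add: spec_le_def PS.ev_basis.op_dim_eq upper_ev_def lap)
    next
      \<comment> \<open>Beyond that dimension the upper endpoint is the default value, so the bound
        by the maximal relative weight takes over.\<close>
      case False
      have "ev (ell2 (verts G), L.gram) (Suc i) \<le> 2 * max_rel_weight G mV mE"
        by (rule LS.ev_le_bound[OF _ i(1)])
          (simp only: L.form_gram winner_self Re_complex_of_real form_le_max_rel_weight)
      then show ?thesis using False card_V by (simp add: upper_ev_def)
    qed
    ultimately have "ev (ell2 (verts G), L.gram) (Suc i) \<in> bracketing_set G mV mE E0 V0"
      using i(1) unfolding bracketing_set_def lap by (intro UN_I[of "Suc i"]) auto
    then show "z \<in> complex_of_real ` bracketing_set G mV mE E0 V0" using i(2) by blast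
  qed
  then show ?thesis using lower upper unfolding lap by blast
qed

end
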